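(* Let $R$ be an order in $K$ and let $S$ be an over-order of $R$. Let $T$ be any over-order of $S$ such that $S^tT$ is invertible as a fractional $T$-ideal. Let $\mathfrak f$ be an ideal contained in $S$ such that $T\subseteq(\mathfrak f:\mathfrak f)$. Then every class in $\mathcal{W}_S(R)$ has a representative $I$ satisfying $\mathfrak f\subseteq I\subseteq T$.
   Context: An order is a commutative reduced ring $R$ with unit that is free and finitely generated as a $\mathbb{Z}$-module; its total quotient ring $K$ is a finite product of number fields, and $R$ is called an order in $K$. A fractional $R$-ideal is a finitely generated sub-$R$-module $I$ of $K$ with $I\otimes_{\mathbb{Z}}\mathbb{Q}=K$. For fractional $R$-ideals $I,J$, $IJ$ is the usual product and $(I:J)=\{x\in K: xJ\subseteq I\}$ (the same formula is used for $(\mathfrak f:\mathfrak f)$). An over-order of $R$ is a fractional $R$-ideal that is a subring of $K$ (so it contains $R$). The multiplicator ring of $I$ is $(I:I)$. A fractional $T$-ideal $I$ is invertible (as a fractional $T$-ideal) if $IJ=T$ for some fractional $T$-ideal $J$. The trace dual of $S$ is $S^t=\{x\in K:\mathrm{Tr}_{K/\mathbb{Q}}(xS)\subseteq\mathbb{Z}\}$, where $\mathrm{Tr}_{K/\mathbb{Q}}(x)$ is the trace of multiplication by $x$ on $K$. Two fractional $R$-ideals $I,J$ are weakly equivalent if they satisfy the following equivalent conditions: $I_{\mathfrak p}\simeq J_{\mathfrak p}$ as $R_{\mathfrak p}$-modules for every maximal ideal $\mathfrak p$ of $R$; $1\in (I:J)(J:I)$; $I$ and $J$ have the same multiplicator ring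 $S$ and $I=LJ$ for some invertible fractional $S$-ideal $L$. $\mathcal{W}_S(R)$ is the set of weak equivalence classes of fractional $R$-ideals $I$ with $(I:I)=S$. *)

theory Defs
  imports Complex_Main
begin

text \<open>
  The algebra \<open>K\<close> is the ambient type; orders, over-orders and fractional ideals are subsets of it.
  Nothing is assumed of the type beyond being a commutative ring: everything else about \<open>K\<close> follows
  from its being the total quotient ring of an order, see \<open>is_order\<close> below.
\<close>

definition is_subring :: "'k::comm_ring_1 set \<Rightarrow> bool" where
  "is_subring R \<longleftrightarrow> 1 \<in> R \<and> (\<forall>x\<in>R. \<forall>y\<in>R. x - y \<in> R \<and> x * y \<in> R)"

definition reduced :: "'k::comm_ring_1 set \<Rightarrow> bool" where
  "reduced R \<longleftrightarrow> (\<forall>x\<in>R. \<forall>n. x ^ n = 0 \<longrightarrow> x = 0)"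

definition nonzerodivisors :: "'k::comm_ring_1 set \<Rightarrow> 'k set" where
  "nonzerodivisors R = {s \<in> R. \<forall>t\<in>R. s * t = 0 \<longrightarrow> t = 0}"

text \<open>The whole type is the total quotient ring of the subring \<open>R\<close>.\<close>

definition has_total_quotient_ring_UNIV :: "'k::comm_ring_1 set \<Rightarrow> bool" where
  "has_total_quotient_ring_UNIV R \<longleftrightarrow>
     (\<forall>s\<in>nonzerodivisors R. s dvd 1) \<and>
     (\<forall>x. \<exists>a\<in>R. \<exists>s\<in>nonzerodivisors R. s * x = a)"

definition zscale :: "int \<Rightarrow> 'k::comm_ring_1 \<Rightarrow> 'k" where
  "zscale n x = of_int n * x"

definition is_order :: "'k::comm_ring_1 set \<Rightarrow> bool" where
  "is_order R \<longleftrightarrow> is_subring R \<and> reduced R \<and>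
     (\<exists>B. finite B \<and> \<not> module.dependent zscale B \<and> module.span zscale B = R) \<and>
     has_total_quotient_ring_UNIV R"

text \<open>
  The rational vector space structure of \<open>K\<close>: \<open>(p / q) x\<close> is the unique \<open>y\<close> with \<open>q y = p x\<close>.  It is
  well defined as soon as \<open>K\<close> contains an order, see \<open>is_order_vector_space\<close> below.
\<close>

definition qscale :: "rat \<Rightarrow> 'k::comm_ring_1 \<Rightarrow> 'k" where
  "qscale q x = (THE y. of_int (snd (quotient_of q)) * y = of_int (fst (quotient_of q)) * x)"

definition is_submodule :: "'k::comm_ring_1 set \<Rightarrow> 'k set \<Rightarrow> bool" where
  "is_submodule R I \<longleftrightarrow> 0 \<in> I \<and> (\<forall>x\<in>I. \<forall>y\<in>I. x + y \<in> I) \<and> (\<forall>r\<in>R. \<forall>x\<in>I. r * x \<in> I)"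

text \<open>
  As \<open>I\<close> is torsion-free, \<open>I \<otimes> \<rat>\<close> is identified with the rational span of \<open>I\<close> in \<open>K\<close>.
\<close>

definition fractional_ideal :: "'k::comm_ring_1 set \<Rightarrow> 'k set \<Rightarrow> bool" where
  "fractional_ideal R I \<longleftrightarrow> is_submodule R I \<and>
     (\<exists>G. finite G \<and> I = {\<Sum>g\<in>G. r g * g | r. \<forall>g\<in>G. r g \<in> R}) \<and>
     module.span qscale I = UNIV"

definition over_order :: "'k::comm_ring_1 set \<Rightarrow> 'k set \<Rightarrow> bool" where
  "over_order R S \<longleftrightarrow> fractional_ideal R S \<and> is_subring S"

definition ideal_prod :: "'k::comm_ring_1 set \<Rightarrow> 'k set \<Rightarrow> 'k set" where
  "ideal_prod I J =
     {\<Sum>i<n. a i * b i | (n::nat) a b. \<forall>i<n. a i \<in> I \<and> b i \<in> J}"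

definition colon :: "'k::comm_ring_1 set \<Rightarrow> 'k set \<Rightarrow> 'k set" where
  "colon I J = {x. \<forall>y\<in>J. x * y \<in> I}"

definition invertible_ideal :: "'k::comm_ring_1 set \<Rightarrow> 'k set \<Rightarrow> bool" where
  "invertible_ideal T I \<longleftrightarrow>
     fractional_ideal T I \<and> (\<exists>J. fractional_ideal T J \<and> ideal_prod I J = T)"

definition is_rat_basis :: "'k::comm_ring_1 set \<Rightarrow> bool" where
  "is_rat_basis B \<longleftrightarrow>
     finite B \<and> \<not> module.dependent qscale B \<and> module.span qscale B = UNIV"

text \<open>
  The trace of multiplication by \<open>x\<close>: the sum of the diagonal entries of its matrix with respect to a
  basis of \<open>K\<close> over the rationals; the choice of the basis is immaterial.
\<close>

definition rat_trace :: "'k::comm_ring_1 \<Rightarrow> rat" where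
  "rat_trace x = (let B = (SOME B. is_rat_basis B) in
     \<Sum>b\<in>B. module.representation qscale B (x * b) b)"

definition trace_dual :: "'k::comm_ring_1 set \<Rightarrow> 'k set" where
  "trace_dual S = {x. \<forall>s\<in>S. rat_trace (x * s) \<in> \<int>}"

definition weak_equivalence :: "'k::comm_ring_1 set \<Rightarrow> ('k set \<times> 'k set) set" where
  "weak_equivalence R = {(I, J). fractional_ideal R I \<and> fractional_ideal R J \<and>
     1 \<in> ideal_prod (colon I J) (colon J I)}"

definition weak_classes :: "'k::comm_ring_1 set \<Rightarrow> 'k set \<Rightarrow> 'k set set set" where
  "weak_classes R S = {I. fractional_ideal R I \<and> colon I I = S} // weak_equivalence R"


lemma module_zscale: "module (zscale :: int \<Rightarrow> 'k::comm_ring_1 \<Rightarrow> 'k)"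
  by unfold_locales (simp_all add: zscale_def algebra_simps)

lemma is_order_torsion_free:
  assumes "is_order R" "x \<in> R" "n \<noteq> 0" "of_int n * x = 0"
  shows "x = 0"
proof -
  interpret module "zscale :: int \<Rightarrow> 'a \<Rightarrow> 'a" by (rule module_zscale)
  obtain B where B: "finite B" "independent B" "span B = R"
    using assms(1) unfolding is_order_def by blast
  obtain u where u: "x = (\<Sum>v\<in>B. zscale (u v) v)"
    using assms(2) B span_finite by blast
  have "(\<Sum>v\<in>B. zscale (n * u v) v) = of_int n * x"
    by (simp add: u sum_distrib_left zscale_def algebra_simps)
  hence "\<forall>v\<in>B. n * u v = 0"
    using independentD[OF B(2) B(1) order.refl, of "\<lambda>v. n * u v"] assms(4) by auto
  thus ?thesis using assms(3) u by (auto simp: zscale_def)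
qed

lemma is_order_of_int_mem: "is_order R \<Longrightarrow> of_int n \<in> R"
proof -
  assume R: "is_order R"
  interpret module "zscale :: int \<Rightarrow> 'a \<Rightarrow> 'a" by (rule module_zscale)
  obtain B where B: "span B = R" "1 \<in> R"
    using R unfolding is_order_def is_subring_def by blast
  have "zscale n 1 \<in> span B" using B by (intro span_scale) auto
  thus ?thesis using B by (simp add: zscale_def)
qed

lemma is_order_of_int_unit:
  assumes "is_order (R :: 'k::comm_ring_1 set)" "n \<noteq> 0"
  shows "(of_int n :: 'k) dvd 1"
proof -
  have "of_int n \<in> nonzerodivisors R"
    using is_order_torsion_free[OF assms(1) _ assms(2)] is_order_of_int_mem[OF assms(1)]
    by (auto simp: nonzerodivisors_def)
  thus ?thesis using assms(1)
    by (auto simp: is_order_def has_total_quotient_ring_UNIV_def)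
qed

lemma is_order_cancel:
  assumes "is_order (R :: 'k::comm_ring_1 set)" "n \<noteq> 0" "of_int n * x = of_int n * (y :: 'k)"
  shows "x = y"
proof -
  obtain w :: 'k where w: "1 = of_int n * w" using is_order_of_int_unit[OF assms(1,2)] by (rule dvdE)
  have "x = w * (of_int n * x)" using w by (metis mult.assoc mult.commute mult_1)
  also have "\<dots> = y" using w assms(3) by (metis mult.assoc mult.commute mult_1)
  finally show ?thesis .
qed

lemma qscale_eq_iff:
  assumes R: "is_order (R :: 'k::comm_ring_1 set)" and b: "b \<noteq> 0" and q: "q = of_int a / of_int b"
  shows "qscale q x = y \<longleftrightarrow> of_int b * y = of_int a * (x :: 'k)"
proof -
  obtain c d where cd: "quotient_of q = (c, d)" by (cases "quotient_of q")
  have d: "d > 0" "q = of_int c / of_int d"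
    using cd quotient_of_denom_pos quotient_of_div by auto
  have "(of_int c * of_int b :: rat) = of_int a * of_int d"
    using d b q by (simp add: field_simps)
  hence cross: "c * b = a * d" by (metis of_int_eq_iff of_int_mult)
  obtain w :: 'k where w: "1 = of_int d * w"
    using is_order_of_int_unit[OF R] d by (metis dvdE less_irrefl)
  have eq: "of_int d * y = of_int c * x \<longleftrightarrow> of_int b * y = of_int a * x" for y
  proof -
    have "of_int d * y = of_int c * x \<longleftrightarrow> of_int b * (of_int d * y) = of_int b * (of_int c * x)"
      using is_order_cancel[OF R b] by metis
    also have "of_int b * (of_int c * x) = of_int (c * b) * x"
      by (simp add: algebra_simps)
    also have "\<dots> = of_int d * (of_int a * x)" by (simp only: cross) (simp add: algebra_simps)
    also have "of_int b * (of_int d * y) = of_int d * (of_int b * y)" by (simp add: algebra_simps)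
    finally show ?thesis using is_order_cancel[OF R, of d] d by (metis less_irrefl)
  qed
  have ex1: "\<exists>!y. of_int d * y = of_int c * x"
  proof (rule ex1I)
    show "of_int d * (w * (of_int c * x)) = of_int c * x"
      using w by (metis mult.assoc mult_1)
    show "y = w * (of_int c * x)" if "of_int d * y = of_int c * x" for y
      using that w by (metis mult.assoc mult.commute mult_1)
  qed
  have "qscale q x = y \<longleftrightarrow> of_int d * y = of_int c * x"
    unfolding qscale_def cd fst_conv snd_conv using theI'[OF ex1] ex1 by (auto intro: the1_equality)
  thus ?thesis using eq by simp
qed

lemma is_order_vector_space:
  assumes R: "is_order (R :: 'k::comm_ring_1 set)"
  shows "vector_space (qscale :: rat \<Rightarrow> 'k \<Rightarrow> 'k)"
proof -
  have rep: "\<exists>a b. b \<noteq> 0 \<and> q = of_int a / of_int b" for q :: rat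
    using quotient_of_div quotient_of_denom_pos by (metis less_irrefl surj_pair)
  have *: "of_int b * qscale (of_int a / of_int b) x = of_int a * x" if "b \<noteq> 0" for a b and x :: 'k
    using qscale_eq_iff[OF R that refl] by blast
  show ?thesis
  proof
    fix q r :: rat and x y :: 'k
    obtain a b where q: "b \<noteq> 0" "q = of_int a / of_int b" using rep by blast
    obtain c d where r: "d \<noteq> 0" "r = of_int c / of_int d" using rep by blast
    have bx: "of_int b * qscale q x = of_int a * x" for x :: 'k using *[OF q(1)] unfolding q(2) .
    have dx: "of_int d * qscale r x = of_int c * x" for x :: 'k using *[OF r(1)] unfolding r(2) .
    show "qscale q (x + y) = qscale q x + qscale q y"
      by (subst qscale_eq_iff[OF R q]) (simp add: distrib_left bx)
    have qr: "q + r = of_int (a * d + c * b) / of_int (b * d)" "q * r = of_int (a * c) / of_int (b * d)"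
      using q r by (simp_all add: field_simps)
    have bd: "b * d \<noteq> 0" using q r by simp
    have "of_int (b * d) * (qscale q x + qscale r x) =
        of_int d * (of_int b * qscale q x) + of_int b * (of_int d * qscale r x)"
      by (simp add: algebra_simps)
    thus "qscale (q + r) x = qscale q x + qscale r x"
      by (subst qscale_eq_iff[OF R bd qr(1)]) (simp add: bx dx algebra_simps)
    have "of_int (b * d) * qscale q (qscale r x) = of_int d * (of_int b * qscale q (qscale r x))"
      by (simp add: algebra_simps)
    also have "\<dots> = of_int a * (of_int d * qscale r x)" by (simp add: bx algebra_simps)
    finally have "of_int (b * d) * qscale q (qscale r x) = of_int (a * c) * x"
      by (simp add: dx algebra_simps)
    thus "qscale q (qscale r x) = qscale (q * r) x"
      using qscale_eq_iff[OF R bd qr(2)] by metis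
    show "qscale 1 x = x"
      by (subst qscale_eq_iff[OF R, of 1 _ 1]) simp_all
  qed
qed

end

theory Submission
  imports Defs "HOL-Library.FuncSet"
begin

text \<open>
  Trace duality gives \<open>I I\<^sup>t = (I : I)\<^sup>t = S\<^sup>t\<close>, so \<open>(I T)(I\<^sup>t T) = S\<^sup>t T\<close> and hence \<open>M = I T\<close> is
  invertible, with inverse \<open>M'\<close> say.  Choose \<open>n > 0\<close> with \<open>n T \<subseteq> S\<close>.  As \<open>T / n T\<close> is finite, \<open>M\<close> is
  principal modulo \<open>n\<close>: there are \<open>m \<in> M\<close>, \<open>m' \<in> M'\<close> with \<open>m m' \<equiv> 1\<close> modulo \<open>n T\<close>.  Then \<open>I' = m' I + n T\<close>
  is weakly equivalent to \<open>I\<close> and \<open>I' T = T\<close>, whence \<open>I' \<subseteq> T\<close> and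
  \<open>\<ff> = \<ff> I' T = \<ff> I' \<subseteq> S I' = I'\<close>.

  Non-degeneracy of the trace form comes for free: otherwise \<open>S\<^sup>t T\<close> would contain a rational line and
  could not be finitely generated.
\<close>

subsection \<open>Products of modules and lattices\<close>

interpretation Z: module "zscale :: int \<Rightarrow> 'k::comm_ring_1 \<Rightarrow> 'k"
  by (rule module_zscale)

lemma ideal_prod_zero: "0 \<in> ideal_prod I J"
  unfolding ideal_prod_def by (auto intro!: exI[of _ "0::nat"])

lemma ideal_prod_mult: "a \<in> I \<Longrightarrow> b \<in> J \<Longrightarrow> a * b \<in> ideal_prod I J"
  unfolding ideal_prod_def mem_Collect_eq
  by (rule exI[of _ 1], rule exI[of _ "\<lambda>_. a"], rule exI[of _ "\<lambda>_. b"]) simp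

lemma ideal_prod_add:
  assumes "x \<in> ideal_prod I J" "y \<in> ideal_prod I J"
  shows "x + y \<in> ideal_prod I J"
proof -
  obtain n a b where x: "x = (\<Sum>i<n::nat. a i * b i)" "\<forall>i<n. a i \<in> I \<and> b i \<in> J"
    using assms(1) unfolding ideal_prod_def by blast
  obtain m c d where y: "y = (\<Sum>i<m::nat. c i * d i)" "\<forall>i<m. c i \<in> I \<and> d i \<in> J"
    using assms(2) unfolding ideal_prod_def by blast
  let ?a = "\<lambda>i. if i < n then a i else c (i - n)" and ?b = "\<lambda>i. if i < n then b i else d (i - n)"
  have "x + y = (\<Sum>i<n + m. ?a i * ?b i)"
    proof -
    have "(\<Sum>i<n + m. ?a i * ?b i) = (\<Sum>i<n. ?a i * ?b i) + (\<Sum>i<m. ?a (n + i) * ?b (n + i))"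
      by (induction m) (simp_all add: add.assoc)
    thus ?thesis by (simp add: x y)
  qed
  moreover have "\<forall>i<n + m. ?a i \<in> I \<and> ?b i \<in> J" using x y by auto
  ultimately show ?thesis unfolding ideal_prod_def mem_Collect_eq
    by (intro exI[of _ "n + m"] exI[of _ ?a] exI[of _ ?b]) (rule conjI)
qed

lemma ideal_prod_induct [consumes 1, case_names zero mult add]:
  assumes "x \<in> ideal_prod I J" and "P 0" and "\<And>a b. a \<in> I \<Longrightarrow> b \<in> J \<Longrightarrow> P (a * b)"
    and "\<And>x y. P x \<Longrightarrow> P y \<Longrightarrow> P (x + y)"
  shows "P x"
proof -
  obtain n a b where x: "x = (\<Sum>i<n::nat. a i * b i)" "\<forall>i<n. a i \<in> I \<and> b i \<in> J"
    using assms(1) unfolding ideal_prod_def by blast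
  have "P (\<Sum>i<k. a i * b i)" if "k \<le> n" for k
    using that by (induction k) (use x assms in auto)
  thus ?thesis using x by simp
qed

lemma is_submodule_diff:
  assumes "is_submodule A I" "- 1 \<in> A" "x \<in> I" "y \<in> I"
  shows "x - y \<in> I"
proof -
  have "x + (- 1) * y \<in> I" using assms unfolding is_submodule_def by blast
  thus ?thesis by simp
qed

lemma is_submodule_sum:
  assumes "is_submodule A I" "\<And>i. i \<in> X \<Longrightarrow> f i \<in> I"
  shows "sum f X \<in> I"
  using assms(2) by (induction X rule: infinite_finite_induct) (use assms(1) in \<open>auto simp: is_submodule_def\<close>)

text \<open>Scalars are absorbed by the second factor alone. This turns
  \<open>ideal_prod I T\<close> into a \<open>T\<close>-module even when \<open>I\<close> is only a
  module over a smaller ring.\<close>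

lemma is_submodule_ideal_prod:
  assumes "is_submodule A J"
  shows "is_submodule A (ideal_prod I J)"
  unfolding is_submodule_def
proof (intro conjI ballI)
  fix r x assume r: "r \<in> A" and x: "x \<in> ideal_prod I J"
  from x show "r * x \<in> ideal_prod I J"
  proof (induction rule: ideal_prod_induct)
    case (mult a b)
    hence "a * (r * b) \<in> ideal_prod I J"
      using assms r by (intro ideal_prod_mult) (auto simp: is_submodule_def)
    thus ?case by (simp add: mult.left_commute)
  qed (auto simp: distrib_left ideal_prod_zero ideal_prod_add)
qed (auto simp: ideal_prod_zero ideal_prod_add)

lemma is_subring_zero: "is_subring A \<Longrightarrow> 0 \<in> A"
  unfolding is_subring_def by (metis diff_self)

lemma is_subring_uminus: "is_subring A \<Longrightarrow> x \<in> A \<Longrightarrow> - x \<in> A"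
  using is_subring_zero unfolding is_subring_def by (metis diff_0)

lemma is_subring_add: "is_subring A \<Longrightarrow> x \<in> A \<Longrightarrow> y \<in> A \<Longrightarrow> x + y \<in> A"
  using is_subring_uminus unfolding is_subring_def by (metis diff_minus_eq_add)

lemma is_subring_of_int: "is_subring A \<Longrightarrow> of_int n \<in> A"
proof -
  assume A: "is_subring A"
  have "of_nat k \<in> A" for k
    by (induction k) (use A is_subring_zero is_subring_add in \<open>auto simp: is_subring_def\<close>)
  thus ?thesis using is_subring_uminus[OF A] by (cases n) (auto simp flip: of_nat_Suc)
qed

lemma is_subring_power: "is_subring A \<Longrightarrow> x \<in> A \<Longrightarrow> x ^ n \<in> A"
  by (induction n) (auto simp: is_subring_def)

lemma is_submodule_imp_subspace:
  assumes "is_subring A" "is_submodule A I"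
  shows "Z.subspace I"
  using assms is_subring_of_int unfolding Z.subspace_def is_submodule_def zscale_def by blast

lemma is_submodule_self: "is_subring A \<Longrightarrow> is_submodule A A"
  using is_subring_zero is_subring_add unfolding is_submodule_def is_subring_def by blast

lemma span_mult_span:
  assumes "x \<in> Z.span A" "y \<in> Z.span B"
  shows "x * y \<in> Z.span {a * b | a b. a \<in> A \<and> b \<in> B}" (is "_ \<in> Z.span ?C")
proof -
  have *: "a * y \<in> Z.span ?C" if "a \<in> A" for a
    using assms(2)
  proof (induction rule: Z.span_induct_alt)
    case (step c b z)
    have "a * b \<in> Z.span ?C" using step that by (intro Z.span_base) auto
    hence "zscale c (a * b) + a * z \<in> Z.span ?C" using step by (intro Z.span_add Z.span_scale)
    moreover have "a * (zscale c b + z) = zscale c (a * b) + a * z"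
      by (simp add: zscale_def algebra_simps)
    ultimately show ?case by simp
  qed (auto simp: Z.span_zero)
  show ?thesis using assms(1)
  proof (induction rule: Z.span_induct_alt)
    case (step c a z)
    hence "zscale c (a * y) + z * y \<in> Z.span ?C" using * by (intro Z.span_add Z.span_scale) auto
    moreover have "(zscale c a + z) * y = zscale c (a * y) + z * y"
      by (simp add: zscale_def algebra_simps)
    ultimately show ?case by simp
  qed (auto simp: Z.span_zero)
qed

lemma finite_products: "finite A \<Longrightarrow> finite B \<Longrightarrow> finite {a * b | a b. a \<in> A \<and> b \<in> (B :: 'a::times set)}"
  by (rule finite_subset[of _ "(\<lambda>(a, b). a * b) ` (A \<times> B)"]) auto

section \<open>Lattices: finitely generated subgroups of full rank\<close>

definition fg :: "'k::comm_ring_1 set \<Rightarrow> bool" where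
  "fg I \<longleftrightarrow> (\<exists>G. finite G \<and> I = Z.span G)"

text \<open>Generation is over the integers, so no ring of multipliers enters. The second clause
  expresses full rank by integers alone and makes sense before \<open>qscale\<close> is known to be
  a scalar multiplication.\<close>

definition lattice :: "'k::comm_ring_1 set \<Rightarrow> bool" where
  "lattice I \<longleftrightarrow> fg I \<and> (\<forall>x. \<exists>n>0. of_int n * x \<in> I)"

lemma lattice_subspace: "lattice I \<Longrightarrow> Z.subspace I"
  unfolding lattice_def fg_def by auto

lemma lattice_zero: "lattice I \<Longrightarrow> 0 \<in> I"
  by (simp add: lattice_subspace Z.subspace_0)

lemma lattice_add: "lattice I \<Longrightarrow> x \<in> I \<Longrightarrow> y \<in> I \<Longrightarrow> x + y \<in> I"
  by (simp add: lattice_subspace Z.subspace_add)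

lemma lattice_of_int_mult: "lattice I \<Longrightarrow> x \<in> I \<Longrightarrow> of_int n * x \<in> I"
  using Z.subspace_scale[OF lattice_subspace, of I x n] by (simp add: zscale_def)

lemma fg_ideal_prod:
  assumes "fg I" "fg J"
  shows "fg (ideal_prod I J)"
proof -
  obtain A B where AB: "finite A" "finite B" "I = Z.span A" "J = Z.span B"
    using assms unfolding fg_def by blast
  let ?C = "{a * b | a b. a \<in> A \<and> b \<in> B}"
  have "x \<in> Z.span ?C" if "x \<in> ideal_prod I J" for x
    using that by (induction rule: ideal_prod_induct)
      (use span_mult_span AB in \<open>auto simp: Z.span_zero intro: Z.span_add\<close>)
  moreover have "Z.subspace (ideal_prod I J)"
    unfolding Z.subspace_def
  proof (intro conjI ballI allI)
    fix c x assume "x \<in> ideal_prod I J"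
    thus "zscale c x \<in> ideal_prod I J"
    proof (induction rule: ideal_prod_induct)
      case (mult a b)
      have "a * zscale c b \<in> ideal_prod I J"
        using mult AB by (intro ideal_prod_mult) (auto intro: Z.span_scale)
      thus ?case by (simp add: zscale_def mult.left_commute)
    qed (auto simp: ideal_prod_zero ideal_prod_add Z.scale_right_distrib)
  qed (auto simp: ideal_prod_zero ideal_prod_add)
  moreover have "?C \<subseteq> ideal_prod I J"
    using AB by (auto intro!: ideal_prod_mult Z.span_base)
  ultimately have "ideal_prod I J = Z.span ?C"
    by (intro equalityI subsetI) (auto dest: Z.span_minimal)
  thus ?thesis unfolding fg_def using finite_products AB by blast
qed

lemma lattice_ideal_prod:
  assumes "lattice I" "lattice J"
  shows "lattice (ideal_prod I J)"
  unfolding lattice_def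
proof (intro conjI allI)
  show "fg (ideal_prod I J)" using assms fg_ideal_prod unfolding lattice_def by blast
  fix x
  obtain n where n: "n > 0" "of_int n * 1 \<in> I" using assms(1) unfolding lattice_def by blast
  obtain m where m: "m > 0" "of_int m * x \<in> J" using assms(2) unfolding lattice_def by blast
  have "of_int (n * m) * x \<in> ideal_prod I J"
    using ideal_prod_mult[OF n(2) m(2)] by (simp add: mult.assoc)
  thus "\<exists>k>0. of_int k * x \<in> ideal_prod I J" using n m by (intro exI[of _ "n * m"]) auto
qed

lemma fg_sum:
  assumes "fg I" "fg J"
  shows "fg {x + y | x y. x \<in> I \<and> y \<in> J}"
proof -
  obtain A B where AB: "finite A" "finite B" "I = Z.span A" "J = Z.span B"
    using assms unfolding fg_def by blast
  show ?thesis unfolding fg_def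
    by (intro exI[of _ "A \<union> B"]) (use AB in \<open>auto simp: Z.span_Un\<close>)
qed

lemma fg_scale:
  assumes "fg I"
  shows "fg ((\<lambda>x. c * x) ` I)"
proof -
  obtain G where G: "finite G" "I = Z.span G" using assms unfolding fg_def by blast
  interpret module_hom zscale zscale "\<lambda>x. c * x"
    by unfold_locales (simp_all add: zscale_def algebra_simps)
  show ?thesis unfolding fg_def using G span_image[of G] by blast
qed

text \<open>Each of the finitely many generators of \<open>J\<close> has a denominator, and their
  product serves all of \<open>J\<close>. It later provides \<open>n\<close> with
  \<open>n T \<subseteq> S\<close>.\<close>

lemma lattice_denominator:
  assumes "fg J" "lattice I"
  obtains n where "n > 0" "\<And>x. x \<in> J \<Longrightarrow> of_int n * x \<in> I"
proof -
  obtain G where G: "finite G" "J = Z.span G" using assms unfolding fg_def by blast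
  obtain d where d: "\<And>x. d x > 0" "\<And>x. of_int (d x) * x \<in> I"
    using assms(2) unfolding lattice_def by metis
  let ?n = "\<Prod>g\<in>G. d g"
  have "of_int ?n * x \<in> I" if "x \<in> J" for x
    using that unfolding G(2)
  proof (induction rule: Z.span_induct_alt)
    case (step c g y)
    have "of_int (\<Prod>h\<in>G - {g}. d h) * (of_int (d g) * g) \<in> I"
      using d assms(2) lattice_of_int_mult by blast
    hence "of_int ?n * g \<in> I"
      using prod.remove[OF G(1) step(1), of d] by (simp add: ac_simps)
    hence "of_int c * (of_int ?n * g) + of_int ?n * y \<in> I"
      using step assms(2) lattice_of_int_mult lattice_add by blast
    thus ?case by (simp add: zscale_def algebra_simps)
  qed (use assms(2) lattice_zero in simp)
  moreover have "?n > 0" using d by (simp add: prod_pos)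
  ultimately show ?thesis using that by blast
qed

subsection \<open>Invertible modules modulo an integer\<close>

lemma is_submodule_add_mult:
  assumes "is_submodule T c"
  shows "x \<in> c \<Longrightarrow> y \<in> c \<Longrightarrow> x + y \<in> c" and "x \<in> c \<Longrightarrow> t \<in> T \<Longrightarrow> x * t \<in> c"
  using assms unfolding is_submodule_def by (auto simp: mult.commute)

text \<open>Fitting decomposition: some power \<open>e\<close> of the last term is idempotent modulo \<open>c\<close>.  The last pair
  takes care of \<open>e\<close>, and the last term is nilpotent on \<open>f = \<epsilon> - e\<close>, so \<open>f\<close> is a sum of the other products.\<close>

lemma sum_of_products_cong_product:
  fixes T :: "'k::comm_ring_1 set" and k :: nat
  assumes T: "is_subring T" and M: "is_submodule T M" and M': "is_submodule T M'"
    and MM': "\<And>a b. a \<in> M \<Longrightarrow> b \<in> M' \<Longrightarrow> a * b \<in> T"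
    and c: "is_submodule T c"
    and pow: "\<And>x. x \<in> T \<Longrightarrow> \<exists>n>0. x ^ n * x ^ n - x ^ n \<in> c"
    and "\<epsilon> \<in> T" "\<epsilon> * \<epsilon> - \<epsilon> \<in> c" "\<And>i. i < k \<Longrightarrow> a i \<in> M \<and> b i \<in> M'"
    and "\<epsilon> - (\<Sum>i<k. a i * b i) \<in> c"
  shows "\<exists>m\<in>M. \<exists>m'\<in>M'. m * m' - \<epsilon> \<in> c"
  using assms(7-)
\<comment> \<open>\<open>\<epsilon>\<close> has to vary because the induction hypothesis is applied
  to the complementary idempotent \<open>f\<close>. The new coefficients are absorbed by the
  \<open>a i\<close>, so \<open>b\<close> can stay fixed.\<close>
proof (induction k arbitrary: \<epsilon> a)
  have neg: "- 1 \<in> T" using is_subring_uminus[OF T] T unfolding is_subring_def by blast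
  note c_diff = is_submodule_diff[OF c neg]
  note c_add = is_submodule_add_mult(1)[OF c]
  note c_mult = is_submodule_add_mult(2)[OF c]
  note T_add = is_subring_add[OF T]
  have T_diff: "x - y \<in> T" and T_mult: "x * y \<in> T" if "x \<in> T" "y \<in> T" for x y
    using T that unfolding is_subring_def by auto
  have M_add: "x + y \<in> M" if "x \<in> M" "y \<in> M" for x y using M that unfolding is_submodule_def by auto
  have M'_add: "x + y \<in> M'" if "x \<in> M'" "y \<in> M'" for x y using M' that unfolding is_submodule_def by auto
  have M_mult: "t * x \<in> M" if "t \<in> T" "x \<in> M" for t x using M that unfolding is_submodule_def by auto
  have M'_mult: "t * x \<in> M'" if "t \<in> T" "x \<in> M'" for t x using M' that unfolding is_submodule_def by auto
  {
    case 0
    have "0 * 0 - \<epsilon> \<in> c" using c_diff[of 0 \<epsilon>] 0 c by (simp add: is_submodule_def)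
    thus ?case using M M' unfolding is_submodule_def by blast
  next
    case (Suc k)
    define p where "p = a k * b k"
    define y where "y = (\<Sum>i<k. a i * b i)"
    \<comment> \<open>The factor \<open>\<epsilon>\<close> keeps the powers of \<open>x\<close> in
      the component of \<open>\<epsilon>\<close>; this gives
      \<open>\<epsilon> * e - e \<in> c\<close> below.\<close>
    define x where "x = \<epsilon> * p"
    have ab: "a k \<in> M" "b k \<in> M'" using Suc.prems by auto
    have pT: "p \<in> T" unfolding p_def using MM' ab .
    have yT: "y \<in> T"
      unfolding y_def by (intro is_submodule_sum[OF is_submodule_self[OF T]]) (use MM' Suc.prems in auto)
    have \<epsilon>T: "\<epsilon> \<in> T" by fact
    have xT: "x \<in> T" unfolding x_def using \<epsilon>T pT by (rule T_mult)
    have d1: "\<epsilon> * \<epsilon> - \<epsilon> \<in> c" by fact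
    have d2: "\<epsilon> - (y + p) \<in> c" using Suc.prems(4) by (simp add: y_def p_def)
    \<comment> \<open>A positive exponent makes \<open>e\<close> divisible by \<open>x\<close>,
      hence by \<open>a k * b k\<close>.\<close>
    obtain n where n: "n > 0" and d3: "x ^ n * x ^ n - x ^ n \<in> c" using pow xT by blast
    then obtain l where l: "n = Suc l" by (cases n) auto
    define e where "e = x ^ n"
    define z where "z = x ^ l"
    have zT: "z \<in> T" unfolding z_def using is_subring_power[OF T xT] .
    have e: "e = x * z" by (simp add: e_def z_def l)
    have eT: "e \<in> T" unfolding e using xT zT by (rule T_mult)
    have d3: "e * e - e \<in> c" using d3 by (simp add: e_def)
    \<comment> \<open>The geometric sum satisfies \<open>(1 - x) * w = 1 - e\<close>. As
      \<open>e * f \<in> c\<close>, it inverts \<open>1 - x\<close> on the component of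
      \<open>f\<close>.\<close>
    define w where "w = (\<Sum>i<n. x ^ i)"
    have wT: "w \<in> T" unfolding w_def
      by (intro is_submodule_sum[OF is_submodule_self[OF T]] is_subring_power[OF T xT])
    have w: "x * w = w - 1 + e"
      using one_diff_power_eq[of x n] by (simp add: w_def e_def algebra_simps)
    have d4: "\<epsilon> * e - e \<in> c"
    proof -
      have "\<epsilon> * e - e = (\<epsilon> * \<epsilon> - \<epsilon>) * (p * z)" by (simp add: e x_def algebra_simps)
      thus ?thesis using c_mult[OF d1 T_mult[OF pT zT]] by simp
    qed
    define f where "f = \<epsilon> - e"
    have fT: "f \<in> T" unfolding f_def using \<epsilon>T eT by (rule T_diff)
    have d5: "e * f \<in> c"
    proof -
      have "e * f = (\<epsilon> * e - e) - (e * e - e)" by (simp add: f_def algebra_simps)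
      thus ?thesis using c_diff[OF d4 d3] by simp
    qed
    have d6: "\<epsilon> * f - f \<in> c"
    proof -
      have "\<epsilon> * f - f = (\<epsilon> * \<epsilon> - \<epsilon>) - (\<epsilon> * e - e)" by (simp add: f_def algebra_simps)
      thus ?thesis using c_diff[OF d1 d4] by simp
    qed
    have d7: "f * f - f \<in> c"
    proof -
      have "f * f - f = (\<epsilon> * f - f) - e * f" by (simp add: f_def algebra_simps)
      thus ?thesis using c_diff[OF d6 d5] by metis
    qed
    have d8: "f - (\<Sum>i<k. (f * w * \<epsilon> * a i) * b i) \<in> c"
    proof -
      have "(\<Sum>i<k. (f * w * \<epsilon> * a i) * b i) = f * w * \<epsilon> * y"
        by (simp add: y_def sum_distrib_left mult.assoc)
      \<comment> \<open>Modulo \<open>c\<close>, \<open>f\<close> is \<open>f * (1 - x) * w\<close>,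
        and \<open>f * (1 - x)\<close> is \<open>f * \<epsilon> * (\<epsilon> - p)\<close>, that is
        \<open>f * \<epsilon> * y\<close>. The exact identity records the error terms of this
        computation.\<close>
      moreover have "f - f * w * \<epsilon> * y = e * f - (\<epsilon> * f - f) * w - (\<epsilon> * \<epsilon> - \<epsilon>) * (f * w)
          + (\<epsilon> - (y + p)) * (f * w * \<epsilon>) + f * (x * w - (w - 1 + e))"
        by (simp add: x_def algebra_simps)
      moreover have "f * (x * w - (w - 1 + e)) = 0" using w by simp
      ultimately show ?thesis
        using c_add[OF c_diff[OF c_diff[OF d5 c_mult[OF d6 wT]] c_mult[OF d1 T_mult[OF fT wT]]]
            c_mult[OF d2 T_mult[OF T_mult[OF fT wT] \<epsilon>T]]] by simp
    qed
    have "f * w * \<epsilon> * a i \<in> M \<and> b i \<in> M'" if "i < k" for i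
      using Suc.prems(3)[of i] that fT wT \<epsilon>T by (auto intro: T_mult M_mult)
    from Suc.IH[OF fT d7 this d8] obtain m m' where m: "m \<in> M" "m' \<in> M'" and d9: "m * m' - f \<in> c"
      by blast
    \<comment> \<open>The two components are glued: \<open>a k * ?z = e\<close> holds exactly, the
      induction hypothesis gives \<open>m * m'\<close> for \<open>f\<close>, and the cross terms are
      multiples of \<open>e * f\<close>, which lies in \<open>c\<close>.\<close>
    let ?z = "\<epsilon> * z * b k"
    let ?m = "e * a k + f * m" and ?m' = "e * ?z + f * m'"
    have zM': "?z \<in> M'" using M'_mult T_mult \<epsilon>T zT ab by blast
    have "a k * ?z = e" by (simp add: e x_def p_def ac_simps)
    moreover have "?m * ?m' = e * e * (a k * ?z) + f * f * (m * m') + e * f * (a k * m' + m * ?z)"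
      by (simp add: algebra_simps)
    ultimately have "?m * ?m' = e * e * e + f * f * (m * m') + e * f * (a k * m' + m * ?z)"
      by simp
    hence "?m * ?m' - \<epsilon> = (e * e - e) * (e + 1) + (f * f - f) * (m * m' + 1) + (m * m' - f) * f
        + e * f * (a k * m' + m * ?z)"
      by (simp add: f_def algebra_simps)
    moreover have "\<dots> \<in> c"
      using T unfolding is_subring_def
      by (intro c_add c_mult d3 d5 d7 d9 T_add MM' fT eT m zM' ab) auto
    moreover have "?m \<in> M" "?m' \<in> M'"
      using m ab zM' eT fT by (auto intro: M_add M_mult M'_add M'_mult)
    ultimately show ?case by metis
  }
qed

text \<open>In the finite ring \<open>T / N T\<close> the powers of \<open>x\<close> are eventually
  periodic. An exponent that is a multiple of the period and lies beyond the preperiod gives an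
  idempotent.\<close>

lemma exists_idempotent_power:
  assumes T: "is_subring T" and "fg T" and "N > 0" and x: "x \<in> T"
  shows "\<exists>n>0. x ^ n * x ^ n - x ^ n \<in> (\<lambda>t. of_int N * t) ` T"
proof -
  let ?c = "(\<lambda>t. of_int N * t) ` T"
  obtain G where G: "finite G" "T = Z.span G" using assms(2) unfolding fg_def by blast
  have "\<exists>u. x ^ n = (\<Sum>g\<in>G. zscale (u g) g)" for n
    using is_subring_power[OF T x] Z.span_finite[OF G(1)] G(2) by blast
  then obtain u where u: "x ^ n = (\<Sum>g\<in>G. zscale (u n g) g)" for n by metis
  \<comment> \<open>Only finitely many residue vectors modulo \<open>N\<close> exist, so two powers
    share one. The coefficients \<open>u n\<close> are merely some choice, but equal residues
    already force the powers to agree modulo \<open>N T\<close>.\<close>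
  define r where "r n = restrict (\<lambda>g. u n g mod N) G" for n :: nat
  have "range r \<subseteq> (\<Pi>\<^sub>E g\<in>G. {0..<N})" using \<open>N > 0\<close> by (auto simp: r_def)
  hence "finite (range r)" by (rule finite_subset) (intro finite_PiE G, simp)
  hence "\<not> inj r" using finite_imageD by fastforce
  then obtain i j where ij: "i < j" "r i = r j"
    unfolding inj_def by (metis linorder_neqE_nat)
  have "\<exists>k. u j g - u i g = N * k" if "g \<in> G" for g
  proof -
    have "u j g mod N = u i g mod N" using fun_cong[OF ij(2), of g] that by (simp add: r_def)
    thus ?thesis by (metis mod_eq_dvd_iff dvdE)
  qed
  then obtain k where k: "g \<in> G \<Longrightarrow> u j g - u i g = N * k g" for g by metis
  have "x ^ j - x ^ i = of_int N * (\<Sum>g\<in>G. zscale (k g) g)"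
  proof -
    have "x ^ j - x ^ i = (\<Sum>g\<in>G. zscale (u j g - u i g) g)"
      by (simp add: u Z.scale_left_diff_distrib sum_subtractf)
    also have "\<dots> = (\<Sum>g\<in>G. of_int N * zscale (k g) g)"
      by (intro sum.cong) (simp_all add: k zscale_def)
    finally show ?thesis by (simp add: sum_distrib_left)
  qed
  moreover have "(\<Sum>g\<in>G. zscale (k g) g) \<in> T"
    unfolding G(2) by (intro Z.span_sum Z.span_scale Z.span_base)
  ultimately obtain t where t: "t \<in> T" "x ^ j - x ^ i = of_int N * t" by blast
  have T_mult: "a * b \<in> T" if "a \<in> T" "b \<in> T" for a b using T that unfolding is_subring_def by auto
  define p where "p = j - i"
  have p: "p > 0" "j = i + p" using ij by (auto simp: p_def)
  have period: "x ^ (i + s + p * q) - x ^ (i + s) \<in> ?c" for s q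
  proof (induction q)
    case 0
    show ?case using is_subring_zero[OF T] by (auto intro: image_eqI[of _ _ 0])
  next
    case (Suc q)
    then obtain t' where t': "t' \<in> T" "x ^ (i + s + p * q) - x ^ (i + s) = of_int N * t'" by auto
    have "x ^ (i + s + p * Suc q) - x ^ (i + s)
        = (x ^ j - x ^ i) * x ^ (s + p * q) + (x ^ (i + s + p * q) - x ^ (i + s))"
      by (simp add: p power_add algebra_simps)
    also have "\<dots> = of_int N * (t * x ^ (s + p * q) + t')"
      unfolding t(2) t'(2) by (simp add: algebra_simps)
    finally show ?case
      using is_subring_add[OF T T_mult[OF t(1) is_subring_power[OF T x]] t'(1)] by blast
  qed
  \<comment> \<open>A multiple of the period \<open>p\<close> that is at least \<open>i\<close>:
    taking \<open>i + 1\<close> periods from exponent \<open>?n\<close> leads to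
    \<open>2 * ?n\<close>.\<close>
  let ?n = "p * (i + 1)"
  have n: "i + (?n - i) = ?n" using p by (cases p) auto
  have "x ^ ?n * x ^ ?n - x ^ ?n \<in> ?c"
    using period[of "?n - i" "i + 1"] by (simp only: n power_add)
  thus ?thesis using p by (intro exI[of _ ?n]) auto
qed

text \<open>An invertible module becomes free of rank one over the finite ring
  \<open>T / n T\<close>: the many products summing to 1 collapse to a single one. This is the
  preceding decomposition with \<open>\<epsilon> = 1\<close> and \<open>c = n T\<close>.\<close>

lemma ideal_prod_inverse_cong_one:
  fixes T :: "'k::comm_ring_1 set"
  assumes T: "is_subring T" "fg T" and M: "is_submodule T M" and M': "is_submodule T M'"
    and MM': "\<And>a b. a \<in> M \<Longrightarrow> b \<in> M' \<Longrightarrow> a * b \<in> T"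
    and one: "1 \<in> ideal_prod M M'" and "n > 0"
  obtains m m' t where "m \<in> M" "m' \<in> M'" "t \<in> T" "m * m' = 1 + of_int n * t"
proof -
  let ?c = "(\<lambda>t. of_int n * t) ` T"
  have c: "is_submodule T ?c"
    unfolding is_submodule_def
  proof (intro conjI ballI)
    show "0 \<in> ?c" using is_subring_zero[OF T(1)] by (auto intro: image_eqI[of _ _ 0])
    show "x + y \<in> ?c" if "x \<in> ?c" "y \<in> ?c" for x y
      using that is_subring_add[OF T(1)] by (auto simp flip: distrib_left)
    show "r * x \<in> ?c" if "r \<in> T" "x \<in> ?c" for r x
    proof -
      obtain t where "t \<in> T" "x = of_int n * t" using \<open>x \<in> ?c\<close> by blast
      thus ?thesis using \<open>r \<in> T\<close> T(1) unfolding is_subring_def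
        by (intro image_eqI[of _ _ "r * t"]) (auto simp: mult.left_commute)
    qed
  qed
  obtain k a b where ab: "1 = (\<Sum>i<k::nat. a i * b i)" "\<And>i. i < k \<Longrightarrow> a i \<in> M \<and> b i \<in> M'"
    using one unfolding ideal_prod_def by blast
  have 0: "0 \<in> ?c" using c unfolding is_submodule_def by blast
  have "\<exists>m\<in>M. \<exists>m'\<in>M'. m * m' - 1 \<in> ?c"
  proof (rule sum_of_products_cong_product[OF T(1) M M' MM' c])
    show "\<exists>n>0. x ^ n * x ^ n - x ^ n \<in> ?c" if "x \<in> T" for x
      using exists_idempotent_power[OF T \<open>n > 0\<close> that] .
    show "1 \<in> T" using T unfolding is_subring_def by blast
    show "1 * 1 - 1 \<in> ?c" using 0 by simp
    show "1 - (\<Sum>i<k. a i * b i) \<in> ?c" using 0 by (simp flip: ab(1))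
  qed (use ab(2) in auto)
  then obtain m m' t where "m \<in> M" "m' \<in> M'" "t \<in> T" "m * m' - 1 = of_int n * t" by auto
  thus ?thesis using that by (simp add: algebra_simps)
qed

subsection \<open>Bases of lattices and trace duality\<close>

lemma common_denominator:
  assumes "finite G"
  shows "\<exists>n::int>0. \<forall>v\<in>G. (of_int n * u v :: rat) \<in> \<int>"
  using assms
proof (induction rule: finite_induct)
  case (insert v G)
  then obtain n :: int where n: "n > 0" "\<forall>w\<in>G. of_int n * u w \<in> \<int>" by blast
  obtain a b where ab: "b > 0" "u v = of_int a / of_int b"
    using quotient_of_div quotient_of_denom_pos by (metis surj_pair)
  have "of_int (n * b) * u v \<in> \<int>" using ab by simp
  moreover have "of_int (n * b) * u w \<in> \<int>" if "w \<in> G" for w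
  proof -
    have "of_int b * (of_int n * u w) \<in> \<int>" using n that by (blast intro: Ints_mult[OF Ints_of_int])
    thus ?thesis by (simp add: ac_simps)
  qed
  ultimately show ?case using n ab by (intro exI[of _ "n * b"]) auto
qed (auto intro: exI[of _ 1])

section \<open>The rational vector space structure and integral bases\<close>

locale ambient_order =
  fixes R :: "'k::comm_ring_1 set"
  assumes is_order: "is_order R"
begin

sublocale Q: vector_space "qscale :: rat \<Rightarrow> 'k \<Rightarrow> 'k"
  by (rule is_order_vector_space[OF is_order])

lemma qscale_of_int: "qscale (of_int n) x = zscale n (x :: 'k)"
  unfolding zscale_def by (subst qscale_eq_iff[OF is_order, of 1 _ n]) simp_all

lemma qscale_mult_left: "qscale q x * y = qscale q (x * (y :: 'k))"
proof -
  obtain a b where q: "b \<noteq> 0" "q = of_int a / of_int b"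
    using quotient_of_div quotient_of_denom_pos by (metis less_irrefl surj_pair)
  have "of_int b * qscale q x = of_int a * x" using qscale_eq_iff[OF is_order q] by blast
  hence "of_int b * (qscale q x * y) = of_int a * (x * y)" by (metis mult.assoc)
  thus ?thesis using qscale_eq_iff[OF is_order q] by metis
qed

lemma torsion_free: "n \<noteq> 0 \<Longrightarrow> of_int n * x = 0 \<Longrightarrow> x = (0 :: 'k)"
  using is_order_cancel[OF is_order, of n x 0] by simp

text \<open>Clearing the denominators of a rational combination moves it into \<open>I\<close>. This
  links the tensor condition in \<open>fractional_ideal\<close> to the integral one in
  \<open>lattice\<close>.\<close>

lemma rational_span_eq_UNIV_iff:
  assumes I: "Z.subspace (I :: 'k set)"
  shows "Q.span I = UNIV \<longleftrightarrow> (\<forall>x. \<exists>n>0. of_int n * x \<in> I)"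
proof safe
  fix x assume "Q.span I = UNIV"
  hence "x \<in> Q.span I" by simp
  thus "\<exists>n>0. of_int n * x \<in> I"
  proof (induction rule: Q.span_induct_alt)
    case base
    show ?case using Z.subspace_0[OF I] by (intro exI[of _ 1]) simp
  next
    case (step c x y)
    then obtain n where n: "n > 0" "of_int n * y \<in> I" by blast
    obtain a b where q: "b > 0" "c = of_int a / of_int b"
      using quotient_of_div quotient_of_denom_pos by (metis surj_pair)
    have "of_int b * qscale c x = of_int a * x" using qscale_eq_iff[OF is_order _ q(2)] q(1) by blast
    moreover have "of_int (n * b) * (qscale c x + y) = of_int n * (of_int b * qscale c x) + of_int b * (of_int n * y)"
      by (simp add: algebra_simps)
    ultimately have "of_int (n * b) * (qscale c x + y) = zscale (n * a) x + zscale b (of_int n * y)"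
      by (simp add: zscale_def mult.assoc)
    also have "\<dots> \<in> I" using I step n by (intro Z.subspace_add Z.subspace_scale) auto
    finally show ?case using n q by (intro exI[of _ "n * b"]) auto
  qed
next
  fix x assume "\<forall>x. \<exists>n>0. of_int n * x \<in> I"
  then obtain n where n: "n > 0" "of_int n * x \<in> I" by blast
  have "x = qscale (1 / of_int n) (qscale (of_int n) x)" using n by simp
  also have "\<dots> \<in> Q.span I"
    using n by (intro Q.span_scale Q.span_base) (simp add: qscale_of_int zscale_def)
  finally show "x \<in> Q.span I" .
qed simp

text \<open>A Euclidean step on the coefficients of an integral relation: replacing \<open>v\<close> by \<open>v \<plusminus> w\<close> makes
  the coefficient of \<open>w\<close> smaller.\<close>

lemma integer_relation_reduces_generators:
  assumes "finite G" "v \<in> G" "a v \<noteq> 0" "(\<Sum>v\<in>G. zscale (a v) v) = (0 :: 'k)"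
  shows "\<exists>H. finite H \<and> card H < card G \<and> Z.span H = Z.span G"
  using assms
\<comment> \<open>The measure is the total size of the coefficients, since a step usually exchanges
  a generator without losing one.\<close>
proof (induction "nat (\<Sum>v\<in>G. \<bar>a v\<bar>)" arbitrary: G a v rule: less_induct)
  case less
  show ?case
  proof (cases "\<exists>w\<in>G. w \<noteq> v \<and> a w \<noteq> 0")
    case False
    hence "(\<Sum>v\<in>G. zscale (a v) v) = zscale (a v) v"
      using less.prems by (subst sum.remove[of _ v]) (auto intro!: sum.neutral)
    hence "v = 0" using less.prems torsion_free[of "a v" v] by (simp add: zscale_def)
    hence "Z.span (G - {v}) = Z.span G"
      unfolding Z.span_eq by (auto intro: Z.span_base Z.span_zero)
    moreover have "card (G - {v}) < card G" using less.prems(1,2) by (rule card_Diff1_less)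
    ultimately show ?thesis using less.prems(1) by blast
  next
    case True
    then obtain w where "w \<in> G" "w \<noteq> v" "a w \<noteq> 0" by blast
    then obtain x y where xy: "x \<in> G" "y \<in> G" "x \<noteq> y" "a x \<noteq> 0" "a y \<noteq> 0" "\<bar>a x\<bar> \<le> \<bar>a y\<bar>"
      using less.prems by (metis linear)
    \<comment> \<open>This sign gives \<open>s * a x\<close> the sign of \<open>a y\<close>, so
      subtracting it lowers \<open>\<bar>a y\<bar>\<close> by
      \<open>\<bar>a x\<bar>\<close>.\<close>
    define s where "s = sgn (a x) * sgn (a y)"
    have small: "\<bar>a y - s * a x\<bar> < \<bar>a y\<bar>"
      using xy(4-6) unfolding s_def by (cases "a x > 0"; cases "a y > 0") (auto simp: sgn_if)
    define x' where "x' = x + zscale s y"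
    define F where "F = G - {x}"
    have F: "finite F" "y \<in> F" "G = insert x F" "x \<notin> F"
      using xy less.prems by (auto simp: F_def)
    have span: "Z.span (insert x' F) = Z.span G"
      unfolding Z.span_eq
    proof (intro conjI subsetI)
      fix z assume "z \<in> insert x' F"
      moreover have "x' \<in> Z.span G" unfolding x'_def using xy by (intro Z.span_add Z.span_scale Z.span_base)
      ultimately show "z \<in> Z.span G" using F by (auto intro: Z.span_base)
    next
      fix z assume "z \<in> G"
      have "x' - zscale s y \<in> Z.span (insert x' F)"
        using F by (intro Z.span_diff Z.span_scale Z.span_base) auto
      thus "z \<in> Z.span (insert x' F)" using F \<open>z \<in> G\<close> by (auto simp: x'_def intro: Z.span_base)
    qed
    show ?thesis
    proof (cases "x' \<in> F")
      \<comment> \<open>The exchanged generator is already present, so a generator has been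
        saved.\<close>
      case True
      thus ?thesis using span F by (intro exI[of _ F]) (auto simp: insert_absorb)
    next
      case False
      \<comment> \<open>The relation is rewritten using \<open>x = x' - s y\<close>. The coefficient
        at \<open>x'\<close> is still \<open>a x\<close>, which is nonzero as the induction
        hypothesis requires.\<close>
      define a' where "a' = a(x' := a x, y := a y - s * a x)"
      have yx': "y \<noteq> x'" using F False by auto
      have split: "(\<Sum>v\<in>insert z F. f v) = f z + (f y + sum f (F - {y}))" if "z \<notin> F"
        for z and f :: "'k \<Rightarrow> 'b::comm_monoid_add"
        using F that sum.remove[of F y f] by simp
      have e1: "(\<Sum>v\<in>F - {y}. zscale (a' v) v) = (\<Sum>v\<in>F - {y}. zscale (a v) v)"
        using False by (intro sum.cong) (auto simp: a'_def)
      have e2: "(\<Sum>v\<in>F - {y}. \<bar>a' v\<bar>) = (\<Sum>v\<in>F - {y}. \<bar>a v\<bar>)"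
        using False by (intro sum.cong) (auto simp: a'_def)
      have "(\<Sum>v\<in>insert x' F. zscale (a' v) v)
          = zscale (a x) x' + (zscale (a y - s * a x) y + (\<Sum>v\<in>F - {y}. zscale (a v) v))"
        unfolding split[OF False] e1 using yx' by (simp add: a'_def)
      also have "\<dots> = (\<Sum>v\<in>G. zscale (a v) v)"
        unfolding F(3) split[OF F(4)] by (simp add: x'_def zscale_def algebra_simps)
      finally have rel: "(\<Sum>v\<in>insert x' F. zscale (a' v) v) = 0" using less.prems by simp
      have "(\<Sum>v\<in>insert x' F. \<bar>a' v\<bar>) = \<bar>a x\<bar> + (\<bar>a y - s * a x\<bar> + (\<Sum>v\<in>F - {y}. \<bar>a v\<bar>))"
        unfolding split[OF False] e2 using yx' by (simp add: a'_def)
      also have "\<dots> < (\<Sum>v\<in>G. \<bar>a v\<bar>)" unfolding F(3) split[OF F(4)] using small by simp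
      finally have "nat (\<Sum>v\<in>insert x' F. \<bar>a' v\<bar>) < nat (\<Sum>v\<in>G. \<bar>a v\<bar>)"
        by (intro nat_less_eq_zless[THEN iffD2]) (auto intro: sum_nonneg)
      from less.hyps[OF this, of x'] rel xy yx' F
      obtain H where "finite H" "card H < card (insert x' F)" "Z.span H = Z.span (insert x' F)"
        by (auto simp: a'_def)
      thus ?thesis using span F False by auto
    qed
  qed
qed

text \<open>Finitely generated torsion-free groups are free. A rational dependence among generators
  becomes an integral relation after clearing denominators, and then fewer generators suffice;
  descent on their number ends in an independent set.\<close>

lemma fg_basis:
  assumes "fg (I :: 'k set)"
  obtains B where "finite B" "Q.independent B" "I = Z.span B"
proof -
  have "\<exists>B. finite B \<and> Q.independent B \<and> Z.span G = Z.span B" if "finite G" for G :: "'k set"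
    using that
  proof (induction "card G" arbitrary: G rule: less_induct)
    case less
    show ?case
    proof (cases "Q.independent G")
      case True
      thus ?thesis using less by blast
    next
      case False
      then obtain u v where u: "v \<in> G" "u v \<noteq> 0" "(\<Sum>v\<in>G. qscale (u v) v) = 0"
        using Q.dependent_finite less.prems by blast
      obtain n :: int where n: "n > 0" "\<forall>v\<in>G. of_int n * u v \<in> \<int>"
        using common_denominator[OF less.prems] by blast
      have "\<forall>v\<in>G. \<exists>k. of_int n * u v = of_int k" using n(2) by (auto elim: Ints_cases)
      from bchoice[OF this] obtain a where a: "\<And>v. v \<in> G \<Longrightarrow> of_int n * u v = of_int (a v)"
        by blast
      have "(\<Sum>v\<in>G. zscale (a v) v) = qscale (of_int n) (\<Sum>v\<in>G. qscale (u v) v)"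
        unfolding Q.scale_sum_right by (intro sum.cong) (simp_all add: a flip: qscale_of_int)
      hence "(\<Sum>v\<in>G. zscale (a v) v) = 0" using u by simp
      moreover have "a v \<noteq> 0" using a[OF u(1)] u n by auto
      ultimately obtain H where "finite H" "card H < card G" "Z.span H = Z.span G"
        using integer_relation_reduces_generators[OF less.prems u(1), of a] by blast
      thus ?thesis using less.hyps by metis
    qed
  qed
  thus ?thesis using assms that unfolding fg_def by metis
qed

lemma lattice_iff_span:
  "lattice I \<longleftrightarrow> fg I \<and> Q.span I = (UNIV :: 'k set)"
  using rational_span_eq_UNIV_iff[of I] unfolding lattice_def fg_def by auto

lemma lattice_basis:
  assumes "lattice (I :: 'k set)"
  obtains B where "is_rat_basis B" "I = Z.span B"
proof -
  have I: "fg I" "Q.span I = UNIV" using assms lattice_iff_span by auto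
  obtain B where B: "finite B" "Q.independent B" "I = Z.span B" using fg_basis[OF I(1)] .
  have "x \<in> Q.span B" if "x \<in> Z.span B" for x
    using that by (induction rule: Z.span_induct_alt)
      (auto simp: Q.span_zero simp flip: qscale_of_int intro: Q.span_add Q.span_scale Q.span_base)
  hence "Q.span B = UNIV" using I(2) B(3) Q.span_minimal[of I "Q.span B"] by auto
  thus ?thesis using that B unfolding is_rat_basis_def by blast
qed

text \<open>\<open>B\<close> ensures that the basis picked by \<open>SOME\<close> in
  \<open>rat_trace\<close> really is one; the coordinates with respect to it are then
  linear.\<close>

lemma linear_rat_trace:
  assumes "is_rat_basis (B :: 'k set)"
  shows "Vector_Spaces.linear qscale (*) (rat_trace :: 'k \<Rightarrow> rat)"
proof -
  define C where "C = (SOME B :: 'k set. is_rat_basis B)"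
  have "is_rat_basis C" unfolding C_def using assms by (rule someI)
  hence C: "Q.independent C" "x \<in> Q.span C" for x unfolding is_rat_basis_def by auto
  have tr: "rat_trace x = (\<Sum>b\<in>C. Q.representation C (x * b) b)" for x
    by (simp add: rat_trace_def C_def Let_def)
  show ?thesis
  proof unfold_locales
    show "rat_trace (x + y) = rat_trace x + rat_trace y" for x y :: 'k
      by (simp add: tr distrib_right Q.representation_add[OF C(1) C(2) C(2)] sum.distrib)
    show "rat_trace (qscale q x) = q * rat_trace x" for q and x :: 'k
      by (simp add: tr qscale_mult_left Q.representation_scale[OF C(1) C(2)] sum_distrib_left)
  qed (simp_all add: algebra_simps)
qed

section \<open>Fractional ideals as lattices\<close>

lemma fractional_ideal_imp_lattice:
  assumes A: "is_subring A" "fg A" and I: "fractional_ideal A (I :: 'k set)"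
  shows "lattice I"
proof -
  have sub: "Z.subspace I"
    using I A is_submodule_imp_subspace unfolding fractional_ideal_def by blast
  obtain B where B: "finite B" "A = Z.span B" using A unfolding fg_def by blast
  obtain G where G: "finite G" "I = {\<Sum>g\<in>G. r g * g | r. \<forall>g\<in>G. r g \<in> A}"
    using I unfolding fractional_ideal_def by blast
  \<comment> \<open>Generators of \<open>I\<close> over \<open>A\<close> times integral generators
    of \<open>A\<close> generate \<open>I\<close> over the integers.\<close>
  let ?C = "{b * g | b g. b \<in> B \<and> g \<in> G}"
  have "b * g \<in> I" if "b \<in> B" "g \<in> G" for b g
  proof -
    let ?r = "\<lambda>h. if h = g then b else 0"
    have "b * g = (\<Sum>h\<in>G. ?r h * h)" using G(1) that by (simp add: if_distrib[of "\<lambda>x. x * _"] cong: if_cong)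
    moreover have "\<forall>h\<in>G. ?r h \<in> A" using that B Z.span_base Z.span_zero by auto
    ultimately show ?thesis unfolding G(2) mem_Collect_eq by (intro exI[of _ ?r] conjI)
  qed
  moreover have "x \<in> Z.span ?C" if "x \<in> I" for x
  proof -
    obtain r where "x = (\<Sum>g\<in>G. r g * g)" "\<forall>g\<in>G. r g \<in> A"
      using \<open>x \<in> I\<close> unfolding G(2) by auto
    thus ?thesis using B(2) by (simp add: Z.span_sum span_mult_span Z.span_base)
  qed
  ultimately have "I = Z.span ?C"
    using Z.span_minimal[OF _ sub, of ?C] by blast
  hence "fg I" unfolding fg_def using finite_products[OF B(1) G(1)] by blast
  thus ?thesis using I lattice_iff_span unfolding fractional_ideal_def by blast
qed

lemma lattice_imp_fractional_ideal:
  assumes A: "is_subring A" and I: "is_submodule A I" "lattice (I :: 'k set)"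
  shows "fractional_ideal A I"
proof -
  obtain G where G: "finite G" "I = Z.span G" using I unfolding lattice_def fg_def by blast
  have "x \<in> I \<longleftrightarrow> (\<exists>r. x = (\<Sum>g\<in>G. r g * g) \<and> (\<forall>g\<in>G. r g \<in> A))" for x
  proof
    assume "x \<in> I"
    then obtain u where "x = (\<Sum>g\<in>G. zscale (u g) g)" using G Z.span_finite by blast
    thus "\<exists>r. x = (\<Sum>g\<in>G. r g * g) \<and> (\<forall>g\<in>G. r g \<in> A)"
      using is_subring_of_int[OF A] by (intro exI[of _ "\<lambda>g. of_int (u g)"]) (simp add: zscale_def)
  next
    assume "\<exists>r. x = (\<Sum>g\<in>G. r g * g) \<and> (\<forall>g\<in>G. r g \<in> A)"
    moreover have "G \<subseteq> I" using G Z.span_superset by blast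
    ultimately show "x \<in> I"
      using I(1) by (auto intro!: is_submodule_sum[OF I(1)] simp: is_submodule_def)
  qed
  hence "I = {\<Sum>g\<in>G. r g * g | r. \<forall>g\<in>G. r g \<in> A}" by blast
  thus ?thesis using G(1) I lattice_iff_span unfolding fractional_ideal_def by blast
qed

section \<open>The trace form and trace duals\<close>

lemma qscale_mult_right: "y * qscale q x = qscale q (y * (x :: 'k))"
  using qscale_mult_left[of q x y] by (simp add: mult.commute)

lemma rat_trace_simps:
  assumes "is_rat_basis (B :: 'k set)"
  shows "rat_trace (0 :: 'k) = 0" "rat_trace (x + y :: 'k) = rat_trace x + rat_trace y"
    "rat_trace (x - y :: 'k) = rat_trace x - rat_trace y"
    "rat_trace (qscale q x :: 'k) = q * rat_trace x"
    "rat_trace (zscale n x :: 'k) = of_int n * rat_trace x"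
    "rat_trace (y * (\<Sum>i\<in>X. qscale (u i) (h i)) :: 'k) = (\<Sum>i\<in>X. u i * rat_trace (y * h i))"
proof -
  interpret T: Vector_Spaces.linear qscale "(*)" "rat_trace :: 'k \<Rightarrow> rat"
    using assms by (rule linear_rat_trace)
  show "rat_trace (0 :: 'k) = 0" "rat_trace (x + y :: 'k) = rat_trace x + rat_trace y"
    "rat_trace (x - y :: 'k) = rat_trace x - rat_trace y"
    and *: "\<And>q x. rat_trace (qscale q x :: 'k) = q * rat_trace x"
    by (fact T.zero T.add T.diff T.scale)+
  show "rat_trace (zscale n x :: 'k) = of_int n * rat_trace x" by (simp add: * flip: qscale_of_int)
  show "rat_trace (y * (\<Sum>i\<in>X. qscale (u i) (h i)) :: 'k) = (\<Sum>i\<in>X. u i * rat_trace (y * h i))"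
    by (simp add: sum_distrib_left qscale_mult_right T.sum *)
qed

lemma subspace_trace_dual:
  assumes "is_rat_basis (B :: 'k set)"
  shows "Z.subspace (trace_dual I :: 'k set)"
  unfolding Z.subspace_def trace_dual_def
  by (auto simp: rat_trace_simps[OF assms] distrib_right)
     (metis Ints_mult Ints_of_int mult.assoc rat_trace_simps(5)[OF assms] zscale_def)

lemma trace_dual_span:
  assumes "is_rat_basis (B :: 'k set)"
  shows "trace_dual (Z.span G) = {x :: 'k. \<forall>g\<in>G. rat_trace (x * g) \<in> \<int>}"
proof (intro equalityI subsetI CollectI)
  fix x :: 'k assume x: "x \<in> {x. \<forall>g\<in>G. rat_trace (x * g) \<in> \<int>}"
  have "rat_trace (x * s) \<in> \<int>" if "s \<in> Z.span G" for s
    using that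
  proof (induction rule: Z.span_induct_alt)
    case (step c g y)
    have "x * (zscale c g + y) = zscale c (x * g) + x * y" by (simp add: zscale_def algebra_simps)
    thus ?case using x step by (simp add: rat_trace_simps[OF assms])
  qed (simp add: rat_trace_simps[OF assms])
  thus "x \<in> trace_dual (Z.span G)" unfolding trace_dual_def by blast
qed (auto simp: trace_dual_def intro: Z.span_base)

lemma trace_dual_lattice:
  assumes nondeg: "\<forall>x :: 'k. (\<forall>y. rat_trace (x * y) = 0) \<longrightarrow> x = 0" and "lattice (I :: 'k set)"
  shows "lattice (trace_dual I)" and "trace_dual (trace_dual I) = I"
proof -
  obtain B where B: "is_rat_basis B" "I = Z.span B" using lattice_basis assms(2) by blast
  hence B': "finite B" "Q.independent B" "Q.span B = UNIV" unfolding is_rat_basis_def by auto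
  note tr = rat_trace_simps[OF B(1)]
  interpret fin: finite_dimensional_vector_space qscale B
    by unfold_locales (use B' in auto)
  have expand: "\<exists>u. x = (\<Sum>b\<in>B. qscale (u b) b)" for x
    using Q.span_finite[OF B'(1)] B'(3) by auto
  have zero: "x = 0" if "\<And>b. b \<in> B \<Longrightarrow> rat_trace (x * b) = 0" for x
  proof (rule nondeg[rule_format])
    fix y
    obtain u where "y = (\<Sum>b\<in>B. qscale (u b) b)" using expand by blast
    thus "rat_trace (x * y) = 0" using that by (simp add: tr)
  qed
  \<comment> \<open>\<open>A\<close> stores the traces against \<open>B\<close> as coordinates in
    \<open>B\<close>. This makes it an endomorphism of a finite-dimensional space, so injectivity
    implies surjectivity, and preimages of the elements of \<open>B\<close> form the dual
    basis.\<close>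
  define A where "A x = (\<Sum>b\<in>B. qscale (rat_trace (x * b)) b)" for x
  have linA: "Vector_Spaces.linear qscale qscale A"
    by unfold_locales (simp_all add: A_def distrib_right tr qscale_mult_left Q.scale_left_distrib
        sum.distrib Q.scale_sum_right)
  have indep: "u b = v b" if "(\<Sum>b\<in>B. qscale (u b) b) = (\<Sum>b\<in>B. qscale (v b) b)" "b \<in> B" for u v b
    using Q.independentD[OF B'(2,1) order.refl, of "\<lambda>b. u b - v b" b] that
    by (simp add: Q.scale_left_diff_distrib sum_subtractf)
  have "inj A"
  proof (rule injI)
    fix x y assume "A x = A y"
    hence "rat_trace (x * b) = rat_trace (y * b)" if "b \<in> B" for b
      unfolding A_def using indep[of "\<lambda>b. rat_trace (x * b)" "\<lambda>b. rat_trace (y * b)"] that by blast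
    hence "x - y = 0" by (intro zero) (simp add: left_diff_distrib tr)
    thus "x = y" by simp
  qed
  hence "surj A" using fin.linear_inj_imp_surj[OF linA] by blast
  then obtain d where d: "A (d x) = x" for x by (metis surjD)
  have dual: "rat_trace (d b * c) = (if c = b then 1 else 0)" if "b \<in> B" "c \<in> B" for b c
  proof -
    have "A (d b) = (\<Sum>c\<in>B. qscale (if c = b then 1 else 0) c)"
      unfolding d using that B'(1) by (simp add: if_distrib[of "\<lambda>q. qscale q _"] cong: if_cong)
    thus ?thesis unfolding A_def
      using indep[of "\<lambda>c. rat_trace (d b * c)" "\<lambda>c. if c = b then 1 else 0"] that by blast
  qed
  have span: "(\<Sum>b\<in>B. qscale (q b) (h b)) \<in> Z.span (h ` B)"
    if "\<And>b. b \<in> B \<Longrightarrow> q b \<in> \<int>" for q and h :: "'k \<Rightarrow> 'k"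
  proof (intro Z.span_sum)
    fix b assume b: "b \<in> B"
    from that[OF this] obtain n where "q b = of_int n" by (rule Ints_cases)
    thus "qscale (q b) (h b) \<in> Z.span (h ` B)"
      using b by (auto simp: qscale_of_int intro: Z.span_scale Z.span_base)
  qed
  have x_eq: "x = (\<Sum>b\<in>B. qscale (rat_trace (x * d b)) b)" for x
  proof -
    obtain u where u: "x = (\<Sum>b\<in>B. qscale (u b) b)" using expand by blast
    have "rat_trace (x * d c) = u c" if "c \<in> B" for c
    proof -
      have "rat_trace (d c * x) = (\<Sum>b\<in>B. u b * (if b = c then 1 else 0))"
        unfolding u tr using that by (intro sum.cong) (simp_all add: dual)
      thus ?thesis using that B'(1) by (simp add: mult.commute if_distrib cong: if_cong)
    qed
    thus ?thesis using u by simp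
  qed
  have x_eq_dual: "x = (\<Sum>b\<in>B. qscale (rat_trace (x * b)) (d b))" for x
  proof -
    let ?y = "\<Sum>b\<in>B. qscale (rat_trace (x * b)) (d b)"
    have "rat_trace ((x - ?y) * c) = 0" if "c \<in> B" for c
    proof -
      have "rat_trace (c * ?y) = (\<Sum>b\<in>B. rat_trace (x * b) * (if c = b then 1 else 0))"
        unfolding tr using that by (intro sum.cong) (simp_all add: dual mult.commute[of c])
      also have "\<dots> = rat_trace (x * c)" using that B'(1) by (simp add: if_distrib cong: if_cong)
      finally have "rat_trace (c * ?y) = rat_trace (c * x)" by (simp add: mult.commute)
      moreover have "(x - ?y) * c = c * x - c * ?y" by (metis mult.commute right_diff_distrib)
      ultimately show ?thesis by (simp only: tr(3))
    qed
    thus ?thesis using zero[of "x - ?y"] by simp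
  qed
  have "trace_dual I = Z.span (d ` B)"
  proof (intro equalityI Z.span_minimal subspace_trace_dual[OF B(1)] subsetI)
    fix x assume "x \<in> trace_dual I"
    thus "x \<in> Z.span (d ` B)"
      unfolding B(2) trace_dual_span[OF B(1)]
      using span[of "\<lambda>b. rat_trace (x * b)" d] x_eq_dual[of x] by auto
  next
    fix x assume "x \<in> d ` B"
    thus "x \<in> trace_dual I" unfolding B(2) trace_dual_span[OF B(1)] using dual by auto
  qed
  moreover have "\<exists>n>0. of_int n * x \<in> trace_dual I" for x
  proof -
    obtain n :: int where n: "n > 0" "\<forall>b\<in>B. of_int n * rat_trace (x * b) \<in> \<int>"
      using common_denominator[OF B'(1), of "\<lambda>b. rat_trace (x * b)"] by blast
    hence "of_int n * x \<in> trace_dual I"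
      unfolding B(2) trace_dual_span[OF B(1)]
      by (simp add: tr(5)[unfolded zscale_def] mult.assoc)
    thus ?thesis using n by blast
  qed
  ultimately show "lattice (trace_dual I)" unfolding lattice_def fg_def using B'(1) by blast
  show "trace_dual (trace_dual I) = I"
  proof (intro equalityI subsetI)
    fix x assume "x \<in> trace_dual (trace_dual I)"
    hence "rat_trace (x * d b) \<in> \<int>" if "b \<in> B" for b
      using that \<open>trace_dual I = Z.span (d ` B)\<close> trace_dual_span[OF B(1), of "d ` B"] by auto
    thus "x \<in> I" using span[of "\<lambda>b. rat_trace (x * d b)" "\<lambda>b. b"] x_eq[of x] B(2) by simp
  next
    fix x assume "x \<in> I"
    thus "x \<in> trace_dual (trace_dual I)" unfolding trace_dual_def by (auto simp: mult.commute)
  qed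
qed

text \<open>One inclusion moves \<open>s\<close> from \<open>a * b * s\<close> onto
  \<open>a\<close>. For the other, if \<open>x\<close> is in the dual of the product then
  \<open>x I\<close> lies in the double dual of \<open>I\<close>, which is \<open>I\<close>; so that
  dual lies in \<open>(I : I)\<close>, and dualizing once more gives the claim.\<close>

lemma ideal_prod_trace_dual:
  assumes nondeg: "\<forall>x :: 'k. (\<forall>y. rat_trace (x * y) = 0) \<longrightarrow> x = 0" and I: "lattice (I :: 'k set)"
  shows "ideal_prod I (trace_dual I) = trace_dual (colon I I)"
proof (intro equalityI subsetI)
  obtain B where B: "is_rat_basis (B :: 'k set)" using lattice_basis I by blast
  fix x assume "x \<in> ideal_prod I (trace_dual I)"
  thus "x \<in> trace_dual (colon I I)"
  proof (induction rule: ideal_prod_induct)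
    case (mult a b)
    have "rat_trace (a * b * s) \<in> \<int>" if "s \<in> colon I I" for s
    proof -
      have "rat_trace (b * (s * a)) \<in> \<int>" using mult that unfolding colon_def trace_dual_def by blast
      thus ?thesis by (simp add: ac_simps)
    qed
    thus ?case unfolding trace_dual_def by blast
  qed (use subspace_trace_dual[OF B] in \<open>auto intro: Z.subspace_0 Z.subspace_add\<close>)
next
  let ?P = "ideal_prod I (trace_dual I)"
  note dual = trace_dual_lattice[OF nondeg]
  have P: "lattice ?P" using I dual(1)[OF I] by (rule lattice_ideal_prod)
  have "x * y \<in> I" if "x \<in> trace_dual ?P" "y \<in> I" for x y
  proof -
    have "rat_trace (x * y * z) \<in> \<int>" if "z \<in> trace_dual I" for z
      using \<open>x \<in> _\<close> ideal_prod_mult[OF \<open>y \<in> I\<close> that] unfolding trace_dual_def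
      by (simp add: mult.assoc)
    hence "x * y \<in> trace_dual (trace_dual I)" unfolding trace_dual_def[of "trace_dual I"] by blast
    thus ?thesis using dual(2)[OF I] by simp
  qed
  hence "trace_dual ?P \<subseteq> colon I I" unfolding colon_def by blast
  hence "trace_dual (colon I I) \<subseteq> trace_dual (trace_dual ?P)" unfolding trace_dual_def by blast
  thus "x \<in> ?P" if "x \<in> trace_dual (colon I I)" for x using that dual(2)[OF P] by blast
qed

text \<open>An element \<open>x\<close> of the radical has all its rational multiples in
  \<open>trace_dual S\<close>, hence in \<open>M\<close>. Elements of \<open>M\<close> have integral
  coordinates in a basis of \<open>M\<close>, which a nonzero rational line violates.\<close>

lemma rat_trace_nondegenerate:
  assumes B0: "is_rat_basis (B0 :: 'k set)" and M: "fg (M :: 'k set)" "trace_dual S \<subseteq> M"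
    and x: "\<And>y. rat_trace (x * y) = 0"
  shows "x = (0 :: 'k)"
proof (rule ccontr)
  assume "x \<noteq> 0"
  obtain B where B: "finite B" "Q.independent B" "M = Z.span B" using fg_basis[OF M(1)] .
  have "y \<in> Q.span B \<and> (\<forall>b. Q.representation B y b \<in> \<int>)" if "y \<in> Z.span B" for y
    using that
  proof (induction rule: Z.span_induct_alt)
    case (step c v y)
    have v: "v \<in> Q.span B" "qscale (of_int c) v \<in> Q.span B"
      using step by (auto intro: Q.span_base Q.span_scale)
    have "Q.representation B (qscale (of_int c) v + y) b
        = of_int c * (if b = v then 1 else 0) + Q.representation B y b" for b
      using step v by (simp add: Q.representation_add[OF B(2)] Q.representation_scale[OF B(2)]
          Q.representation_basis[OF B(2)])
    thus ?case using step v Q.span_add by (simp add: qscale_of_int)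
  qed (simp add: Q.representation_zero Q.span_zero)
  hence in_span: "y \<in> Q.span B" and integral: "Q.representation B y b \<in> \<int>" if "y \<in> Z.span B" for y b
    using that by auto
  have line: "qscale q x \<in> Z.span B" for q
  proof -
    have "qscale q x \<in> trace_dual S"
      unfolding trace_dual_def by (simp add: qscale_mult_left rat_trace_simps(4)[OF B0] x)
    thus ?thesis using M B by blast
  qed
  have xB: "x \<in> Q.span B" using in_span[OF line[of 1]] by simp
  obtain b where b: "Q.representation B x b \<noteq> 0"
    using Q.sum_representation_eq[OF B(2) xB B(1) order.refl] \<open>x \<noteq> 0\<close> by force
  \<comment> \<open>The scalar is chosen to make the coordinate at \<open>b\<close> equal to
    \<open>1 / 2\<close>.\<close>
  let ?q = "1 / (2 * Q.representation B x b)"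
  have "Q.representation B (qscale ?q x) b = 1 / 2"
    using b by (simp add: Q.representation_scale[OF B(2) xB])
  hence "(1 / 2 :: rat) \<in> \<int>" using integral[OF line[of ?q], of b] by metis
  then obtain k :: int where "(1 / 2 :: rat) = of_int k" by (rule Ints_cases)
  hence "(of_int 1 :: rat) = of_int (2 * k)" by simp
  hence "1 = 2 * k" by (simp only: of_int_eq_iff)
  thus False by presburger
qed

subsection \<open>The representative\<close>

text \<open>This carries out the construction with \<open>J\<close> an inverse of
  \<open>ideal_prod (trace_dual S) T\<close>. Finite generation of the latter supplies nondegeneracy
  of the trace.\<close>

lemma weakly_equivalent_between:
  fixes I S T \<ff> J :: "'k set"
  assumes S: "is_subring S" "lattice S" and T: "is_subring T" "lattice T"
    and I: "is_submodule R I" "lattice I" "colon I I = S" and RST: "R \<subseteq> S" "S \<subseteq> T"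
    and J: "is_submodule T J" "lattice J" "ideal_prod (ideal_prod (trace_dual S) T) J = T"
    and dual_fg: "fg (ideal_prod (trace_dual S) T)"
    and \<ff>: "\<ff> \<subseteq> S" "T \<subseteq> colon \<ff> \<ff>"
  shows "\<exists>I'. (I, I') \<in> weak_equivalence R \<and> \<ff> \<subseteq> I' \<and> I' \<subseteq> T"
proof -
  have R: "is_subring R" using is_order unfolding is_order_def by blast
  have T_mult: "x * y \<in> T" if "x \<in> T" "y \<in> T" for x y using T(1) that unfolding is_subring_def by blast
  have T_one: "1 \<in> T" using T(1) unfolding is_subring_def by blast
  have SI: "s * x \<in> I" if "s \<in> S" "x \<in> I" for s x using I(3) that unfolding colon_def by blast
  note I_add = lattice_add[OF I(2)] and T_add = lattice_add[OF T(2)]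

  obtain B where B: "is_rat_basis (B :: 'k set)" using lattice_basis I(2) by blast
  have "trace_dual S \<subseteq> ideal_prod (trace_dual S) T"
    using ideal_prod_mult[OF _ T_one] by fastforce
  hence nondeg: "\<forall>x :: 'k. (\<forall>y. rat_trace (x * y) = 0) \<longrightarrow> x = 0"
    using rat_trace_nondegenerate[OF B dual_fg] by blast
  have dual: "ideal_prod I (trace_dual I) = trace_dual S"
    using ideal_prod_trace_dual[OF nondeg I(2)] I(3) by simp

  define M where "M = ideal_prod I T"
  \<comment> \<open>\<open>M'\<close> is inverse to \<open>M\<close>: the product \<open>I T\<close>
    times \<open>I\<^sup>t J\<close> regroups as \<open>S\<^sup>t T J\<close>, which is
    \<open>T\<close>. The two inclusions are \<open>MM'\<close> and \<open>T_MM'\<close>.\<close>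
  define M' where "M' = ideal_prod (trace_dual I) J"
  have M: "is_submodule T M" unfolding M_def using T(1) is_submodule_self is_submodule_ideal_prod by blast
  have M': "is_submodule T M'" unfolding M'_def using J(1) by (rule is_submodule_ideal_prod)
  have MT: "x * t \<in> M" if "x \<in> M" "t \<in> T" for x t
    using M that unfolding is_submodule_def by (metis mult.commute)
  have IM: "x \<in> M" if "x \<in> I" for x
    unfolding M_def using ideal_prod_mult[OF that T_one] by simp
  have MM': "x * y \<in> T" if "x \<in> M" "y \<in> M'" for x y
    using that(1) unfolding M_def
  proof (induction rule: ideal_prod_induct)
    case (mult a t)
    from that(2) show ?case unfolding M'_def
    proof (induction rule: ideal_prod_induct)
      case (mult a' j)
      have "a * a' \<in> trace_dual S" using ideal_prod_mult[OF \<open>a \<in> I\<close> mult(1)] by (simp only: dual)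
      hence "a * a' * t * j \<in> ideal_prod (ideal_prod (trace_dual S) T) J"
        using \<open>t \<in> T\<close> mult(2) by (intro ideal_prod_mult)
      hence "a * a' * t * j \<in> T" by (simp only: J(3))
      thus ?case by (simp add: ac_simps)
    qed (simp_all add: distrib_left lattice_zero[OF T(2)] T_add)
  qed (simp_all add: distrib_right lattice_zero[OF T(2)] T_add)
  have T_MM': "z \<in> ideal_prod M M'" if "z \<in> T" for z
  proof -
    from that have "z \<in> ideal_prod (ideal_prod (trace_dual S) T) J" by (simp only: J(3))
    thus ?thesis
    proof (induction rule: ideal_prod_induct)
      case (mult u j)
      from mult(1) show ?case
      proof (induction rule: ideal_prod_induct)
        case (mult s t)
        from mult(1) show ?case unfolding dual[symmetric]
        proof (induction rule: ideal_prod_induct)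
          case (mult a a')
          have "a * t * (a' * j) \<in> ideal_prod M M'"
            using mult \<open>t \<in> T\<close> \<open>j \<in> J\<close> unfolding M_def M'_def by (intro ideal_prod_mult)
          thus ?case by (simp add: ac_simps)
        qed (auto simp: distrib_right ideal_prod_zero ideal_prod_add)
      qed (auto simp: distrib_right ideal_prod_zero ideal_prod_add)
    qed (auto simp: ideal_prod_zero ideal_prod_add)
  qed

  obtain n where n: "n > 0" and nT: "\<And>t. t \<in> T \<Longrightarrow> of_int n * t \<in> S"
    using lattice_denominator[of T S] S T unfolding lattice_def by blast
  \<comment> \<open>Since \<open>n T\<close> lies in \<open>S\<close>, multiplication by
    \<open>n\<close> sends \<open>M = I T\<close> into \<open>S I = I\<close>.\<close>
  have nM: "of_int n * u \<in> I" if "u \<in> M" for u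
    using that unfolding M_def
  proof (induction rule: ideal_prod_induct)
    case (mult a t)
    thus ?case using SI[OF nT[of t], of a] by (simp add: ac_simps)
  qed (auto simp: distrib_left lattice_zero[OF I(2)] I_add)
  obtain m m' t0 where m: "m \<in> M" "m' \<in> M'" "t0 \<in> T" "m * m' = 1 + of_int n * t0"
    using ideal_prod_inverse_cong_one[OF T(1) _ M M' MM' T_MM'[OF T_one] n] T(2)
    unfolding lattice_def by blast
  \<comment> \<open>Being 1 modulo \<open>n T\<close>, the product lies in \<open>S\<close> and so
    maps \<open>I\<close> into itself.\<close>
  have mm': "m * m' \<in> S"
    unfolding m(4) using nT[OF m(3)] S(1) is_subring_add unfolding is_subring_def by blast

  define I' where "I' = {x + y | x y. x \<in> (\<lambda>x. m' * x) ` I \<and> y \<in> (\<lambda>t. of_int n * t) ` T}"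
  have I'I: "m' * x + of_int n * t \<in> I'" if "x \<in> I" "t \<in> T" for x t
    unfolding I'_def using that by blast
  have I'E: "\<exists>x t. x \<in> I \<and> t \<in> T \<and> z = m' * x + of_int n * t" if "z \<in> I'" for z
    using that unfolding I'_def by blast
  have "lattice I'"
    unfolding lattice_def
  proof (intro conjI allI)
    show "fg I'" unfolding I'_def using I(2) T(2) unfolding lattice_def by (intro fg_sum fg_scale) auto
    fix x
    obtain k where "k > 0" "of_int k * x \<in> T" using T(2) unfolding lattice_def by blast
    moreover from this have "of_int (n * k) * x \<in> I'"
      using I'I[OF lattice_zero[OF I(2)]] by (simp add: mult.assoc)
    ultimately show "\<exists>k>0. of_int k * x \<in> I'" using n by (intro exI[of _ "n * k"]) auto
  qed
  moreover have "is_submodule R I'"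
    unfolding is_submodule_def
  proof (intro conjI ballI)
    show "0 \<in> I'" using I'I[OF lattice_zero[OF I(2)] lattice_zero[OF T(2)]] by simp
    fix z w assume "z \<in> I'" "w \<in> I'"
    then obtain x t y s where "x \<in> I" "t \<in> T" "z = m' * x + of_int n * t"
      "y \<in> I" "s \<in> T" "w = m' * y + of_int n * s"
      using I'E by meson
    thus "z + w \<in> I'" using I'I[OF I_add[of x y] T_add[of t s]] by (simp add: algebra_simps)
  next
    fix r z assume r: "r \<in> R" and "z \<in> I'"
    then obtain x t where x: "x \<in> I" "t \<in> T" "z = m' * x + of_int n * t" using I'E by meson
    have "r \<in> S" "r \<in> T" using r RST by auto
    hence "m' * (r * x) + of_int n * (r * t) \<in> I'" using x SI T_mult by (intro I'I) auto
    thus "r * z \<in> I'" by (simp add: x algebra_simps)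
  qed
  ultimately have "fractional_ideal R I'" using R lattice_imp_fractional_ideal by blast
  moreover have "fractional_ideal R I" using R I lattice_imp_fractional_ideal by blast
  moreover have "1 \<in> ideal_prod (colon I I') (colon I' I)"
  proof -
    \<comment> \<open>The two colon modules contain \<open>m\<close>, \<open>n M\<close> and
      \<open>m'\<close>, \<open>n M'\<close> respectively. These elements suffice to produce
      1.\<close>
    have colon1: "m \<in> colon I I'"
      unfolding colon_def
    proof (intro CollectI ballI)
      fix z assume "z \<in> I'"
      then obtain x t where x: "x \<in> I" "t \<in> T" "z = m' * x + of_int n * t" using I'E by meson
      have "m * m' * x + of_int n * (m * t) \<in> I"
        using x SI[OF mm'] nM MT m by (intro I_add) auto
      thus "m * z \<in> I" by (simp add: x algebra_simps)
    qed
    have colon2: "of_int n * u \<in> colon I I'" if u: "u \<in> M" for u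
      unfolding colon_def
    proof (intro CollectI ballI)
      fix z assume "z \<in> I'"
      then obtain x t where x: "x \<in> I" "t \<in> T" "z = m' * x + of_int n * t" using I'E by meson
      have "of_int n * (u * m') * x + of_int n * (of_int n * (u * t)) \<in> I"
        using x u SI nT MM' m nM MT lattice_of_int_mult[OF I(2)] by (intro I_add) auto
      thus "of_int n * u * z \<in> I" by (simp add: x algebra_simps)
    qed
    have colon3: "m' \<in> colon I' I"
      unfolding colon_def using I'I[OF _ lattice_zero[OF T(2)]] by auto
    have colon4: "of_int n * v \<in> colon I' I" if v: "v \<in> M'" for v
      unfolding colon_def
    proof (intro CollectI ballI)
      fix x assume "x \<in> I"
      hence "m' * 0 + of_int n * (x * v) \<in> I'" using MM' IM v lattice_zero[OF I(2)] by (intro I'I) auto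
      thus "of_int n * v * x \<in> I'" by (simp add: algebra_simps)
    qed
    let ?P = "ideal_prod (colon I I') (colon I' I)"
    \<comment> \<open>Since \<open>T = M M'\<close>, the products of \<open>n M\<close> with
      \<open>n M'\<close> fill up \<open>n\<^sup>2 T\<close>.\<close>
    have sq: "of_int n * of_int n * z \<in> ?P" if "z \<in> T" for z
      using T_MM'[OF that]
    proof (induction rule: ideal_prod_induct)
      case (mult a b)
      have "of_int n * a * (of_int n * b) \<in> ?P" using mult colon2 colon4 by (intro ideal_prod_mult) auto
      thus ?case by (simp add: algebra_simps)
    qed (auto simp: distrib_left ideal_prod_zero ideal_prod_add)
    have t0: "- t0 \<in> T" using is_subring_uminus[OF T(1) m(3)] .
    \<comment> \<open>With \<open>m * m' = 1 + n t0\<close>, multiplying by \<open>1 - n t0\<close>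
      leaves \<open>1 - n\<^sup>2 t0\<^sup>2\<close>, and the missing square is in
      \<open>n\<^sup>2 T\<close>.\<close>
    have "m * m' + of_int n * (m * (- t0)) * m' + of_int n * of_int n * (t0 * t0) \<in> ?P"
      by (intro ideal_prod_add ideal_prod_mult colon1 colon2 colon3 sq MT T_mult m t0)
    moreover have "m * m' + of_int n * (m * (- t0)) * m' + of_int n * of_int n * (t0 * t0)
        = m * m' * (1 - of_int n * t0) + of_int n * of_int n * (t0 * t0)"
      by (simp add: algebra_simps)
    moreover have "\<dots> = 1" unfolding m(4) by (simp add: algebra_simps)
    ultimately show ?thesis by simp
  qed
  ultimately have "(I, I') \<in> weak_equivalence R" unfolding weak_equivalence_def by blast
  moreover have "I' \<subseteq> T"
  proof
    fix z assume "z \<in> I'"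
    then obtain x t where x: "x \<in> I" "t \<in> T" "z = m' * x + of_int n * t" using I'E by meson
    thus "z \<in> T"
      using MM'[OF IM[OF x(1)] m(2)] T_add lattice_of_int_mult[OF T(2)] by (simp add: mult.commute)
  qed
  moreover have "\<ff> \<subseteq> I'"
  proof
    fix z assume z: "z \<in> \<ff>"
    \<comment> \<open>\<open>T\<close> preserves \<open>\<ff>\<close>, so in
      \<open>z * (a * t)\<close> the factor \<open>t\<close> can be moved onto \<open>z\<close>,
      giving an element of \<open>\<ff> \<subseteq> S\<close> that acts on \<open>a\<close>.\<close>
    have "z * u \<in> I" if "u \<in> M" for u
      using that unfolding M_def
    proof (induction rule: ideal_prod_induct)
      case (mult a t)
      have "t * z \<in> S" using \<ff> z mult unfolding colon_def by blast
      hence "t * z * a \<in> I" using mult SI by blast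
      thus ?case by (simp add: ac_simps)
    qed (auto simp: distrib_left lattice_zero[OF I(2)] I_add)
    moreover have "z * (- t0) \<in> T"
      using z \<ff>(1) RST(2) is_subring_uminus[OF T(1) m(3)] by (intro T_mult) auto
    \<comment> \<open>Solving \<open>m * m' = 1 + n t0\<close> for 1 and multiplying by
      \<open>z\<close> splits \<open>z\<close> into a part in \<open>m' I\<close> and a part in
      \<open>n T\<close>.\<close>
    ultimately have "m' * (z * m) + of_int n * (z * (- t0)) \<in> I'" using m by (intro I'I) auto
    moreover have "m' * (z * m) + of_int n * (z * (- t0)) = z * (m * m') - z * (of_int n * t0)"
      by (simp add: algebra_simps)
    ultimately show "z \<in> I'" unfolding m(4) by (simp add: algebra_simps)
  qed
  ultimately show ?thesis by blast
qed

end

theorem proposition5p1: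
  fixes R S T \<ff> :: "'k::comm_ring_1 set"
  assumes "is_order R"
    and "over_order R S"
    and "over_order S T"
    and "invertible_ideal T (ideal_prod (trace_dual S) T)"
    and "is_submodule R \<ff>" and "\<ff> \<subseteq> S"
    and "T \<subseteq> colon \<ff> \<ff>"
  shows "\<forall>C \<in> weak_classes R S. \<exists>I \<in> C. \<ff> \<subseteq> I \<and> I \<subseteq> T"
proof
  interpret ambient_order R by unfold_locales (rule assms(1))
  fix C assume "C \<in> weak_classes R S"
  \<comment> \<open>The class is the image of one member \<open>I\<close>, so anything weakly
    equivalent to \<open>I\<close> belongs to it.\<close>
  then obtain I where I: "fractional_ideal R I" "colon I I = S" "C = weak_equivalence R `` {I}"
    unfolding weak_classes_def quotient_def by blast
  have R: "is_subring R" "fg R"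
    using assms(1) unfolding is_order_def fg_def by auto
  \<comment> \<open>Integral finite generation climbs the chain: \<open>R\<close> has it as an
    order, which makes the fractional \<open>R\<close>-ideal \<open>S\<close> a lattice, and this in
    turn makes \<open>T\<close> one.\<close>
  have S: "is_subring S" "lattice S" "is_submodule R S"
    using assms(2) fractional_ideal_imp_lattice[OF R] unfolding over_order_def fractional_ideal_def by auto
  have fgS: "fg S" using S(2) unfolding lattice_def by blast
  have T: "is_subring T" "lattice T" "is_submodule S T"
    using assms(3) fractional_ideal_imp_lattice[OF S(1) fgS]
    unfolding over_order_def fractional_ideal_def by auto
  have fgT: "fg T" using T(2) unfolding lattice_def by blast
  note lat = fractional_ideal_imp_lattice[OF T(1) fgT]
  obtain J where J: "fractional_ideal T J" "ideal_prod (ideal_prod (trace_dual S) T) J = T"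
    and D: "fractional_ideal T (ideal_prod (trace_dual S) T)"
    using assms(4) unfolding invertible_ideal_def by blast
  have "\<exists>I'. (I, I') \<in> weak_equivalence R \<and> \<ff> \<subseteq> I' \<and> I' \<subseteq> T"
  proof (rule weakly_equivalent_between)
    \<comment> \<open>Each ring is a module over the previous one and contains 1, so it contains
      \<open>r * 1\<close> for every scalar \<open>r\<close>.\<close>
    show "R \<subseteq> S" "S \<subseteq> T"
      using S T unfolding is_submodule_def is_subring_def by (metis mult.right_neutral subsetI)+
    show "is_submodule R I" "is_submodule T J"
      using I(1) J(1) unfolding fractional_ideal_def by auto
    show "lattice I" using fractional_ideal_imp_lattice[OF R I(1)] .
    show "fg (ideal_prod (trace_dual S) T)" using lat[OF D] unfolding lattice_def by blast
  qed (fact S T I J lat[OF J(1)] assms)+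
  thus "\<exists>I\<in>C. \<ff> \<subseteq> I \<and> I \<subseteq> T" unfolding I(3) by blast
qed

end
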